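(* Let $H\in(0,1)$, let $C$ be a Cauchy process and let $B_H$ be a fractional Brownian motion with Hurst parameter $H$, independent of $C$. The density $$q(x,t)=2\int_0^\infty\frac{s}{\pi(s^2+x^2)}\,\frac{e^{-s^2/(2t^{2H})}}{\sqrt{2\pi t^{2H}}}\,ds$$ of the process $I_{CB_H}(t)=C(|B_H(t)|)$, $t>0$, is a solution of the non-homogeneous heat equation $$\frac{\partial q}{\partial t}=\frac{2Ht^{H-1}}{\pi x^2\sqrt{2\pi}}-Ht^{2H-1}\frac{\partial^2q}{\partial x^2},\qquad x\in\mathbb{R}\setminus\{0\},\ t>0 .$$
   Context: The Cauchy process $C(t)$, $t>0$, is the process whose law at time $t$ has density $\frac{t}{\pi(t^2+x^2)}$, $x\in\mathbb{R}$ (standard symmetric Cauchy Lévy process). A fractional Brownian motion $B_H$ with Hurst parameter $H\in(0,1)$ is a centred Gaussian process with covariance $E\{B_H(s)B_H(t)\}=\frac12\left(|t|^{2H}+|s|^{2H}-|t-s|^{2H}\right)$. *)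

theory Defs
  imports "HOL-Probability.Probability"
begin

text \<open>All processes are real-valued, defined on a probability space \<open>M\<close> and indexed by the
  times \<open>t \<ge> 0\<close>; their values at negative times are irrelevant.\<close>

definition cadlag_on_nonneg :: "(real \<Rightarrow> real) \<Rightarrow> bool" where
  "cadlag_on_nonneg f \<longleftrightarrow>
     (\<forall>t\<ge>0. continuous (at_right t) f) \<and> (\<forall>t>0. \<exists>l. (f \<longlongrightarrow> l) (at_left t))"

text \<open>Every path, not only almost every path, is required to be cadlag. This makes
  \<open>C\<close> evaluated at an independent random time a random variable even if \<open>M\<close> is not complete.\<close>

definition levy_process :: "'a measure \<Rightarrow> (real \<Rightarrow> 'a \<Rightarrow> real) \<Rightarrow> bool" where
  "levy_process M X \<longleftrightarrow>
     (\<forall>t\<ge>0. X t \<in> borel_measurable M) \<and>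
     (AE \<omega> in M. X 0 \<omega> = 0) \<and>
     (\<forall>(\<tau> :: nat \<Rightarrow> real) n. 0 \<le> \<tau> 0 \<longrightarrow> mono \<tau> \<longrightarrow>
        prob_space.indep_vars M (\<lambda>_. borel) (\<lambda>i \<omega>. X (\<tau> (Suc i)) \<omega> - X (\<tau> i) \<omega>) {..<n}) \<and>
     (\<forall>s\<ge>0. \<forall>h\<ge>0. distr M borel (\<lambda>\<omega>. X (s + h) \<omega> - X s \<omega>) = distr M borel (X h)) \<and>
     (\<forall>\<omega>\<in>space M. cadlag_on_nonneg (\<lambda>t. X t \<omega>))"

definition cauchy_process :: "'a measure \<Rightarrow> (real \<Rightarrow> 'a \<Rightarrow> real) \<Rightarrow> bool" where
  "cauchy_process M C \<longleftrightarrow>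
     levy_process M C \<and>
     (\<forall>t>0. distributed M lborel (C t) (\<lambda>x. ennreal (t / (pi * (t\<^sup>2 + x\<^sup>2)))))"

text \<open>Degenerate (almost surely constant) Gaussian variables are included.\<close>

definition gaussian_variable :: "'a measure \<Rightarrow> ('a \<Rightarrow> real) \<Rightarrow> bool" where
  "gaussian_variable M X \<longleftrightarrow>
     X \<in> borel_measurable M \<and>
     ((\<exists>\<mu>. AE \<omega> in M. X \<omega> = \<mu>) \<or>
      (\<exists>\<mu> \<sigma>. 0 < \<sigma> \<and> distributed M lborel X (\<lambda>x. ennreal (normal_density \<mu> \<sigma> x))))"

definition gaussian_process :: "'a measure \<Rightarrow> (real \<Rightarrow> 'a \<Rightarrow> real) \<Rightarrow> bool" where
  "gaussian_process M X \<longleftrightarrow>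
     (\<forall>J (a :: real \<Rightarrow> real). finite J \<longrightarrow> J \<subseteq> {0..} \<longrightarrow>
        gaussian_variable M (\<lambda>\<omega>. \<Sum>t\<in>J. a t * X t \<omega>))"

definition fractional_brownian_motion :: "'a measure \<Rightarrow> real \<Rightarrow> (real \<Rightarrow> 'a \<Rightarrow> real) \<Rightarrow> bool" where
  "fractional_brownian_motion M H B \<longleftrightarrow>
     gaussian_process M B \<and>
     (\<forall>t\<ge>0. prob_space.expectation M (B t) = 0) \<and>
     (\<forall>s\<ge>0. \<forall>t\<ge>0. prob_space.expectation M (\<lambda>\<omega>. B s \<omega> * B t \<omega>) =
        (\<bar>t\<bar> powr (2 * H) + \<bar>s\<bar> powr (2 * H) - \<bar>t - s\<bar> powr (2 * H)) / 2)"

text \<open>Independence of the whole processes, i.e. of the sigma-algebras they generate.\<close>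

definition independent_processes ::
    "'a measure \<Rightarrow> (real \<Rightarrow> 'a \<Rightarrow> real) \<Rightarrow> (real \<Rightarrow> 'a \<Rightarrow> real) \<Rightarrow> bool" where
  "independent_processes M X Y \<longleftrightarrow>
     prob_space.indep_var M
       (PiM {0..} (\<lambda>_. borel)) (\<lambda>\<omega>. \<lambda>t\<in>{0..}. X t \<omega>)
       (PiM {0..} (\<lambda>_. borel)) (\<lambda>\<omega>. \<lambda>t\<in>{0..}. Y t \<omega>)"

text \<open>For \<open>x = 0\<close> the integral diverges and the Lebesgue integral below is \<open>0\<close> by convention;
  a single point does not affect a density.\<close>

definition q_density :: "real \<Rightarrow> real \<Rightarrow> real \<Rightarrow> real" where
  "q_density H x t =
     2 * (LBINT s:{0..}. s / (pi * (s\<^sup>2 + x\<^sup>2)) *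
            (exp (- s\<^sup>2 / (2 * t powr (2 * H))) / sqrt (2 * pi * t powr (2 * H))))"

end

(* With sigma = t powr H, substituting s = sigma * u writes q as twice the half-line integral of
   k(sigma u, x) phi(u), where phi is the standard normal density and k(s, x) = s / (pi (s^2 + x^2)).
   The parameters x and t then occur only in k, whose derivatives are dominated away from x = 0.
   In the sigma-derivative, u phi(u) = - phi'(u) and an integration by parts produce the boundary
   term phi(0) / (pi x^2), which is the inhomogeneity, and k_ss, which is - k_xx because k is harmonic.

   For the law of C(|B(t)|): right-continuity of the paths makes it the limit of C at the grid points
   just above |B(t)|, for which independence of C and B can be used pointwise in time. *)

theory Submission
  imports Defs "HOL-Real_Asymp.Real_Asymp"
begin

section \<open>The Cauchy kernel against the half-normal weight\<close>

text \<open>The coefficients of the equation come from the chain rule. The factor H t^(H-1), the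
  derivative of sigma, multiplies the boundary term 2 phi(0) / (pi x^2). Differentiating k_s(sigma
  u, x) in u leaves one sigma in front of k_xx, and sigma times H t^(H-1) is H t^(2H-1). For the
  law, the obstacle is that evaluating a path at a variable time is not jointly measurable for the
  product sigma-algebra in which independence is stated. For a time with countably many values it
  is, since only countably many coordinates are involved. The passage to the limit is made inside
  integrals of continuous functions with values in [0, 1]: these follow the convergence along paths,
  and they still determine a law on the line.\<close>

lemma has_real_derivative_lebesgue_integral:
  fixes f f' :: "real \<Rightarrow> 'a \<Rightarrow> real"
  assumes "0 < d"
    and int: "\<And>y. \<bar>y - x\<bar> < d \<Longrightarrow> integrable M (f y)"
    and der: "\<And>y s. \<bar>y - x\<bar> < d \<Longrightarrow> ((\<lambda>y. f y s) has_real_derivative f' y s) (at y)"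
    and bound: "\<And>y s. \<bar>y - x\<bar> < d \<Longrightarrow> \<bar>f' y s\<bar> \<le> h s"
    and h: "integrable M h"
    and meas: "f' x \<in> borel_measurable M"
  shows "((\<lambda>y. \<integral>s. f y s \<partial>M) has_real_derivative (\<integral>s. f' x s \<partial>M)) (at x)"
proof -
  \<comment> \<open>Working within the ball keeps every \<open>X i\<close> where the hypotheses
    apply; as the ball is open, the limit is the full derivative.\<close>
  have "((\<lambda>y. ((\<integral>s. f y s \<partial>M) - (\<integral>s. f x s \<partial>M)) / (y - x)) \<longlongrightarrow> (\<integral>s. f' x s \<partial>M)) (at x within ball x d)"
    unfolding tendsto_at_iff_sequentially
  proof (intro allI impI)
    fix X :: "nat \<Rightarrow> real"
    assume X: "\<forall>i. X i \<in> ball x d - {x}" "X \<longlonglongrightarrow> x"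
    then have Xd: "\<bar>X i - x\<bar> < d" and Xne: "X i \<noteq> x" for i
      by (auto simp: dist_real_def abs_minus_commute)
    have intx: "integrable M (f x)" using int[of x] \<open>0 < d\<close> by simp
    have "(\<lambda>i. \<integral>s. (f (X i) s - f x s) / (X i - x) \<partial>M) \<longlonglongrightarrow> (\<integral>s. f' x s \<partial>M)"
    proof (rule integral_dominated_convergence[where w=h])
      show "AE s in M. (\<lambda>i. (f (X i) s - f x s) / (X i - x)) \<longlonglongrightarrow> f' x s"
      proof (rule AE_I2)
        fix s
        have "((\<lambda>y. (f y s - f x s) / (y - x)) \<longlongrightarrow> f' x s) (at x)"
          using der[of x s] \<open>0 < d\<close> by (simp add: has_field_derivative_iff)
        then show "(\<lambda>i. (f (X i) s - f x s) / (X i - x)) \<longlonglongrightarrow> f' x s"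
          unfolding tendsto_at_iff_sequentially comp_def using X(2) Xne by auto
      qed
      fix i
      show "(\<lambda>s. (f (X i) s - f x s) / (X i - x)) \<in> borel_measurable M"
        using int[OF Xd[of i]] intx by measurable
      show "AE s in M. norm ((f (X i) s - f x s) / (X i - x)) \<le> h s"
      proof (rule AE_I2)
        fix s
        \<comment> \<open>The mean value inequality on the ball turns the bound on \<open>f'\<close>
          into a bound on all difference quotients, so \<open>h\<close> dominates the
          sequence.\<close>
        have "norm (f (X i) s - f x s) \<le> h s * norm (X i - x)"
        proof (rule field_differentiable_bound[where S="ball x d" and f'="\<lambda>y. f' y s"])
          fix z assume "z \<in> ball x d"
          then have "\<bar>z - x\<bar> < d" by (auto simp: dist_real_def abs_minus_commute)
          then show "((\<lambda>y. f y s) has_field_derivative f' z s) (at z within ball x d)" "norm (f' z s) \<le> h s"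
            using der[of z s] bound[of z s] by (auto intro: has_field_derivative_at_within)
        qed (use X(1) \<open>0 < d\<close> in auto)
        then show "norm ((f (X i) s - f x s) / (X i - x)) \<le> h s"
          using Xne[of i] by (simp add: norm_divide divide_simps)
      qed
    qed (use h meas in auto)
    then show "((\<lambda>y. ((\<integral>s. f y s \<partial>M) - (\<integral>s. f x s \<partial>M)) / (y - x)) \<circ> X) \<longlonglongrightarrow> (\<integral>s. f' x s \<partial>M)"
      using int[OF Xd] intx by (simp add: comp_def)
  qed
  then show ?thesis
    using \<open>0 < d\<close> by (simp add: has_field_derivative_iff at_within_open[of x "ball x d"])
qed

text \<open>This is the real part of 1 / (pi z) with z = s + i x, the Poisson kernel of the
  half-plane s > 0. Hence it is harmonic away from the origin, and its derivatives are real parts of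
  multiples of powers of 1/z.\<close>

definition cauchy_kernel :: "real \<Rightarrow> real \<Rightarrow> real" where
  "cauchy_kernel s x = s / (pi * (s\<^sup>2 + x\<^sup>2))"

text \<open>The total mass is 1/2: the factor 2 stays outside the integral, as in
  \<open>q_density\<close>. The open half-line matches the open interval on which the integration by
  parts takes place.\<close>

definition half_normal :: "real \<Rightarrow> real" where
  "half_normal u = indicator {0<..} u * std_normal_density u"

definition cauchy_kernel_ds :: "real \<Rightarrow> real \<Rightarrow> real" where
  "cauchy_kernel_ds s x = (x\<^sup>2 - s\<^sup>2) / (pi * (s\<^sup>2 + x\<^sup>2)\<^sup>2)"

definition cauchy_kernel_dx :: "real \<Rightarrow> real \<Rightarrow> real" where
  "cauchy_kernel_dx s x = - (2 * s * x) / (pi * (s\<^sup>2 + x\<^sup>2)\<^sup>2)"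

definition cauchy_kernel_dxx :: "real \<Rightarrow> real \<Rightarrow> real" where
  "cauchy_kernel_dxx s x = (6 * s * x\<^sup>2 - 2 * s ^ 3) / (pi * (s\<^sup>2 + x\<^sup>2) ^ 3)"

lemma cauchy_kernel_measurable [measurable]:
  assumes [measurable]: "f \<in> borel_measurable M" "g \<in> borel_measurable M"
  shows "(\<lambda>u. cauchy_kernel (f u) (g u)) \<in> borel_measurable M"
  unfolding cauchy_kernel_def by measurable

lemma cauchy_kernel_ds_measurable [measurable]:
  assumes [measurable]: "f \<in> borel_measurable M" "g \<in> borel_measurable M"
  shows "(\<lambda>u. cauchy_kernel_ds (f u) (g u)) \<in> borel_measurable M"
  unfolding cauchy_kernel_ds_def by measurable

lemma cauchy_kernel_dx_measurable [measurable]: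
  assumes [measurable]: "f \<in> borel_measurable M" "g \<in> borel_measurable M"
  shows "(\<lambda>u. cauchy_kernel_dx (f u) (g u)) \<in> borel_measurable M"
  unfolding cauchy_kernel_dx_def by measurable

lemma cauchy_kernel_dxx_measurable [measurable]:
  assumes [measurable]: "f \<in> borel_measurable M" "g \<in> borel_measurable M"
  shows "(\<lambda>u. cauchy_kernel_dxx (f u) (g u)) \<in> borel_measurable M"
  unfolding cauchy_kernel_dxx_def by measurable

lemma half_normal_measurable [measurable]: "half_normal \<in> borel_measurable borel"
  unfolding half_normal_def by measurable

lemma half_normal_nonneg: "0 \<le> half_normal u"
  unfolding half_normal_def by simp

lemma integrable_half_normal_moment: "integrable lborel (\<lambda>u. half_normal u * u ^ k)"
proof (rule Bochner_Integration.integrable_bound[OF integrable_std_normal_moment[of k]])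
  show "AE u in lborel. norm (half_normal u * u ^ k) \<le> norm (std_normal_density u * u ^ k)"
    by (auto simp: half_normal_def abs_mult split: split_indicator)
  show "(\<lambda>u. half_normal u * u ^ k) \<in> borel_measurable lborel"
    by simp
qed

lemma integrable_half_normal_mult:
  assumes [measurable]: "g \<in> borel_measurable lborel"
    and "\<And>u. \<bar>g u\<bar> \<le> c * \<bar>u\<bar> ^ k"
  shows "integrable lborel (\<lambda>u. g u * half_normal u)"
proof (rule Bochner_Integration.integrable_bound)
  show "integrable lborel (\<lambda>u. c * (half_normal u * u ^ k))"
    using integrable_half_normal_moment by simp
  show "AE u in lborel. norm (g u * half_normal u) \<le> norm (c * (half_normal u * u ^ k))"
  proof (rule AE_I2)
    fix u
    have "norm (g u * half_normal u) = \<bar>g u\<bar> * half_normal u"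
      by (simp add: abs_mult half_normal_nonneg)
    also have "\<dots> \<le> c * \<bar>u\<bar> ^ k * half_normal u"
      by (rule mult_right_mono[OF assms(2) half_normal_nonneg])
    \<comment> \<open>The sign of \<open>c\<close> is left open, so its absolute value is used in
      the dominating function.\<close>
    also have "\<dots> \<le> \<bar>c\<bar> * (\<bar>u\<bar> ^ k * half_normal u)"
      unfolding mult.assoc by (rule mult_right_mono[OF abs_ge_self]) (simp add: half_normal_nonneg)
    also have "\<dots> = norm (c * (half_normal u * u ^ k))"
      by (simp add: abs_mult power_abs half_normal_nonneg)
    finally show "norm (g u * half_normal u) \<le> norm (c * (half_normal u * u ^ k))" .
  qed
  show "(\<lambda>u. g u * half_normal u) \<in> borel_measurable lborel"
    using half_normal_measurable assms(1) by simp
qed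

text \<open>The quotient rule squares the denominator, and one factor cancels. No condition on
  \<open>r\<close> is needed: at \<open>r\<close> = 0 both sides are 0 by the convention for
  division.\<close>

lemma quotient_cancel: "(n * (pi * r)) / (pi * r\<^sup>2)\<^sup>2 = n / (pi * r ^ 3)" for r :: real
  by (simp add: power2_eq_square power3_eq_cube)

section \<open>Partial derivatives of the kernel and their bounds away from x = 0\<close>

context
  fixes x :: real
  assumes x: "x \<noteq> 0"
begin

lemma sum_squares_gt_zero: "0 < s\<^sup>2 + x\<^sup>2"
  using x by (simp add: add_nonneg_pos)

lemma DERIV_cauchy_kernel_s: "((\<lambda>s. cauchy_kernel s x) has_real_derivative cauchy_kernel_ds s x) (at s)"
proof -
  have "((\<lambda>s. s / (pi * (s\<^sup>2 + x\<^sup>2))) has_real_derivative 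
     (pi * (s\<^sup>2 + x\<^sup>2) - s * (pi * (2 * s))) / (pi * (s\<^sup>2 + x\<^sup>2))\<^sup>2) (at s)"
    using x by (auto intro!: derivative_eq_intros simp: power2_eq_square)
  also have "pi * (s\<^sup>2 + x\<^sup>2) - s * (pi * (2 * s)) = pi * (x\<^sup>2 - s\<^sup>2)"
    by (simp add: algebra_simps power2_eq_square)
  finally show ?thesis by (simp add: power2_eq_square[of pi] power_mult_distrib cauchy_kernel_def cauchy_kernel_ds_def)
qed

text \<open>Harmonicity enters here: the second derivative in \<open>s\<close> is written directly
  as the negative of the second derivative in \<open>x\<close>.\<close>

lemma DERIV_cauchy_kernel_ds:
  "((\<lambda>s. cauchy_kernel_ds s x) has_real_derivative - cauchy_kernel_dxx s x) (at s)"
proof -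
  have "((\<lambda>s. (x\<^sup>2 - s\<^sup>2) / (pi * (s\<^sup>2 + x\<^sup>2)\<^sup>2)) has_real_derivative 
     (- (2 * s) * (pi * (s\<^sup>2 + x\<^sup>2)\<^sup>2) - (x\<^sup>2 - s\<^sup>2) * (pi * (2 * (s\<^sup>2 + x\<^sup>2) * (2 * s)))) / (pi * (s\<^sup>2 + x\<^sup>2)\<^sup>2)\<^sup>2) (at s)"
    using x by (auto intro!: derivative_eq_intros simp: power2_eq_square[of "pi * _"])
  also have "- (2 * s) * (pi * (s\<^sup>2 + x\<^sup>2)\<^sup>2) - (x\<^sup>2 - s\<^sup>2) * (pi * (2 * (s\<^sup>2 + x\<^sup>2) * (2 * s))) = (- (6 * s * x\<^sup>2 - 2 * s ^ 3)) * (pi * (s\<^sup>2 + x\<^sup>2))"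
    by (simp add: algebra_simps power2_eq_square power3_eq_cube)
  finally show ?thesis unfolding quotient_cancel cauchy_kernel_ds_def cauchy_kernel_dxx_def minus_divide_left .
qed

lemma DERIV_cauchy_kernel_x: "(cauchy_kernel s has_real_derivative cauchy_kernel_dx s x) (at x)"
proof -
  have "((\<lambda>x. s / (pi * (s\<^sup>2 + x\<^sup>2))) has_real_derivative
     - (s * (pi * (2 * x))) / (pi * (s\<^sup>2 + x\<^sup>2))\<^sup>2) (at x)"
    using x by (auto intro!: derivative_eq_intros simp: power2_eq_square[of "pi * _"])
  also have "s * (pi * (2 * x)) = pi * (2 * s * x)"
    by simp
  finally show ?thesis by (simp add: power2_eq_square[of pi] power_mult_distrib mult.assoc cauchy_kernel_def[abs_def] cauchy_kernel_dx_def)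
qed

lemma DERIV_cauchy_kernel_dx: "(cauchy_kernel_dx s has_real_derivative cauchy_kernel_dxx s x) (at x)"
proof -
  have "((\<lambda>x. - (2 * s * x)) has_real_derivative - (2 * s)) (at x)"
    and "((\<lambda>x. pi * (s\<^sup>2 + x\<^sup>2)\<^sup>2) has_real_derivative pi * (2 * (s\<^sup>2 + x\<^sup>2) * (2 * x))) (at x)"
    by (auto intro!: derivative_eq_intros)
  from DERIV_divide[OF this] have "((\<lambda>x. - (2 * s * x) / (pi * (s\<^sup>2 + x\<^sup>2)\<^sup>2)) has_real_derivative
     (- (2 * s) * (pi * (s\<^sup>2 + x\<^sup>2)\<^sup>2) - - (2 * s * x) * (pi * (2 * (s\<^sup>2 + x\<^sup>2) * (2 * x)))) / (pi * (s\<^sup>2 + x\<^sup>2)\<^sup>2)\<^sup>2) (at x)"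
    using x by (simp add: power2_eq_square[of "pi * _"])
  also have "- (2 * s) * (pi * (s\<^sup>2 + x\<^sup>2)\<^sup>2) - - (2 * s * x) * (pi * (2 * (s\<^sup>2 + x\<^sup>2) * (2 * x))) = (6 * s * x\<^sup>2 - 2 * s ^ 3) * (pi * (s\<^sup>2 + x\<^sup>2))"
    by (simp add: algebra_simps power2_eq_square power3_eq_cube)
  finally show ?thesis unfolding quotient_cancel cauchy_kernel_dx_def[abs_def] cauchy_kernel_dxx_def .
qed

text \<open>This bound serves differentiation in the scale, where \<open>x\<close> stays fixed; it
  therefore has to be uniform in \<open>s\<close> only.\<close>

lemma cauchy_kernel_ds_bound: "\<bar>cauchy_kernel_ds s x\<bar> \<le> 1 / (pi * x\<^sup>2)"
proof -
  have "\<bar>cauchy_kernel_ds s x\<bar> \<le> (s\<^sup>2 + x\<^sup>2) / (pi * (s\<^sup>2 + x\<^sup>2)\<^sup>2)"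
    unfolding cauchy_kernel_ds_def abs_divide
    by (rule frac_le) (auto simp: sum_squares_gt_zero x intro!: abs_leI)
  also have "\<dots> = 1 / (pi * (s\<^sup>2 + x\<^sup>2))"
    using sum_squares_gt_zero[of s] by (simp add: power2_eq_square)
  also have "\<dots> \<le> 1 / (pi * x\<^sup>2)"
    using x sum_squares_gt_zero[of s] by (intro divide_left_mono mult_pos_pos mult_left_mono) auto
  finally show ?thesis .
qed

context
  fixes c :: real
  assumes c: "0 < c" "c \<le> \<bar>x\<bar>"
begin

text \<open>A lower bound \<open>c\<close> for |x| replaces \<open>x\<close> in the estimates below,
  so that one dominating function serves a whole neighbourhood of positions.\<close>

lemma power2_le_sum_squares: "c\<^sup>2 \<le> s\<^sup>2 + x\<^sup>2"
proof -
  have "c\<^sup>2 \<le> \<bar>x\<bar>\<^sup>2" using c by (intro power_mono) auto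
  then show ?thesis by (simp add: add_increasing)
qed

lemma cauchy_kernel_bound: "\<bar>cauchy_kernel s x\<bar> \<le> 1 / (pi * c\<^sup>2) * \<bar>s\<bar>"
proof -
  have "\<bar>cauchy_kernel s x\<bar> = \<bar>s\<bar> / (pi * (s\<^sup>2 + x\<^sup>2))"
    by (simp add: cauchy_kernel_def abs_mult)
  also have "\<dots> \<le> \<bar>s\<bar> / (pi * c\<^sup>2)"
    using c power2_le_sum_squares[of s] sum_squares_gt_zero[of s] by (intro divide_left_mono mult_pos_pos mult_left_mono) auto
  finally show ?thesis by simp
qed

lemma cauchy_kernel_dx_bound: "\<bar>cauchy_kernel_dx s x\<bar> \<le> 1 / (pi * c\<^sup>2)"
proof -
  have "0 \<le> (\<bar>s\<bar> - \<bar>x\<bar>)\<^sup>2" by simp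
  then have "\<bar>2 * s * x\<bar> \<le> s\<^sup>2 + x\<^sup>2" by (simp add: power2_eq_square algebra_simps abs_mult)
  then have "\<bar>cauchy_kernel_dx s x\<bar> \<le> (s\<^sup>2 + x\<^sup>2) / (pi * (s\<^sup>2 + x\<^sup>2)\<^sup>2)"
    unfolding cauchy_kernel_dx_def abs_divide
    by (intro frac_le) (auto simp: sum_squares_gt_zero x)
  also have "\<dots> = 1 / (pi * (s\<^sup>2 + x\<^sup>2))"
    using sum_squares_gt_zero[of s] by (simp add: power2_eq_square)
  also have "\<dots> \<le> 1 / (pi * c\<^sup>2)"
    using c power2_le_sum_squares[of s] sum_squares_gt_zero[of s] by (intro divide_left_mono mult_pos_pos mult_left_mono) auto
  finally show ?thesis .
qed

text \<open>The constant 6 is crude, from |6 x^2 - 2 s^2| \<le> 6 (s^2 + x^2). The remaining factor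
  |s| only costs a first moment of \<open>half_normal\<close>.\<close>

lemma cauchy_kernel_dxx_bound: "\<bar>cauchy_kernel_dxx s x\<bar> \<le> 6 / (pi * c ^ 4) * \<bar>s\<bar>"
proof -
  have "\<bar>6 * s * x\<^sup>2 - 2 * s ^ 3\<bar> = \<bar>s\<bar> * \<bar>6 * x\<^sup>2 - 2 * s\<^sup>2\<bar>"
    by (simp add: abs_mult[symmetric] algebra_simps power2_eq_square power3_eq_cube)
  also have "\<dots> \<le> \<bar>s\<bar> * (6 * (s\<^sup>2 + x\<^sup>2))"
    by (intro mult_left_mono abs_leI) (auto simp: algebra_simps)
  finally have *: "\<bar>6 * s * x\<^sup>2 - 2 * s ^ 3\<bar> \<le> \<bar>s\<bar> * (6 * (s\<^sup>2 + x\<^sup>2))" .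
  have "\<bar>cauchy_kernel_dxx s x\<bar> \<le> \<bar>s\<bar> * (6 * (s\<^sup>2 + x\<^sup>2)) / (pi * (s\<^sup>2 + x\<^sup>2) ^ 3)"
    unfolding cauchy_kernel_dxx_def abs_divide
    using * sum_squares_gt_zero[of s] by (intro frac_le) (auto simp: abs_mult)
  also have "\<dots> = 6 * \<bar>s\<bar> / (pi * (s\<^sup>2 + x\<^sup>2)\<^sup>2)"
  proof -
    have "a * (6 * r) / (pi * r ^ 3) = 6 * a / (pi * r\<^sup>2)" if "0 < r" for a r :: real
      using that by (simp add: power2_eq_square power3_eq_cube)
    then show ?thesis using sum_squares_gt_zero[of s] by blast
  qed
  also have "\<dots> \<le> 6 * \<bar>s\<bar> / (pi * (c\<^sup>2)\<^sup>2)"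
    using c power2_le_sum_squares[of s] sum_squares_gt_zero[of s]
    by (intro divide_left_mono mult_pos_pos mult_left_mono power_mono) auto
  finally show ?thesis by simp
qed

end

end

text \<open>The Jacobian sigma cancels the sigma in the normalising square root. The identity
  includes \<open>x\<close> = 0: both integrals diverge there, and the Lebesgue integral takes its
  default value 0 on both sides. This makes it usable for measurability in \<open>x\<close>.\<close>

lemma q_density_scale:
  assumes "0 < t"
  shows "q_density H x t = 2 * (\<integral>u. cauchy_kernel (t powr H * u) x * half_normal u \<partial>lborel)"
proof -
  define \<sigma> where "\<sigma> = t powr H"
  have \<sigma>: "0 < \<sigma>" using assms by (simp add: \<sigma>_def)
  have sq: "t powr (2 * H) = \<sigma>\<^sup>2"
    by (simp add: \<sigma>_def power2_eq_square powr_add[symmetric])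
  let ?g = "\<lambda>s. s / (pi * (s\<^sup>2 + x\<^sup>2)) * (exp (- s\<^sup>2 / (2 * \<sigma>\<^sup>2)) / sqrt (2 * pi * \<sigma>\<^sup>2))"
  have "q_density H x t = 2 * (\<integral>s. indicator {0..} s * ?g s \<partial>lborel)"
    unfolding q_density_def set_lebesgue_integral_def sq by simp
  also have "(\<integral>s. indicator {0..} s * ?g s \<partial>lborel) =
      \<sigma> * (\<integral>u. indicator {0..} (\<sigma> * u) * ?g (\<sigma> * u) \<partial>lborel)"
    using lborel_integral_real_affine[of \<sigma> "\<lambda>s. indicator {0..} s * ?g s" 0] \<sigma> by simp
  also have "\<dots> = (\<integral>u. \<sigma> * (indicator {0..} (\<sigma> * u) * ?g (\<sigma> * u)) \<partial>lborel)"
    by (rule integral_mult_right_zero[symmetric])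
  also have "\<dots> = (\<integral>u. cauchy_kernel (\<sigma> * u) x * half_normal u \<partial>lborel)"
  proof (rule Bochner_Integration.integral_cong[OF refl])
    fix u :: real
    have sqrt_eq: "sqrt (2 * pi * \<sigma>\<^sup>2) = sqrt (2 * pi) * \<sigma>"
      using \<sigma> by (simp add: real_sqrt_mult)
    have exp_eq: "exp (- (\<sigma> * u)\<^sup>2 / (2 * \<sigma>\<^sup>2)) = exp (- u\<^sup>2 / 2)"
      using \<sigma> by (simp add: power_mult_distrib)
    \<comment> \<open>The indicators differ at \<open>u\<close> = 0, closed on the left and open on
      the right, but the kernel vanishes there.\<close>
    show "\<sigma> * (indicator {0..} (\<sigma> * u) * ?g (\<sigma> * u)) = cauchy_kernel (\<sigma> * u) x * half_normal u"
      unfolding sqrt_eq exp_eq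
      using \<sigma> by (auto simp: cauchy_kernel_def half_normal_def std_normal_density_def zero_le_mult_iff split: split_indicator)
  qed
  finally show ?thesis unfolding \<sigma>_def .
qed

text \<open>The radius |x|/2 keeps \<open>y\<close> off the singularity and supplies the value
  \<open>c\<close> = |x|/2 for the uniform bounds.\<close>

lemma half_abs_neighbourhood:
  fixes x y :: real
  assumes x: "x \<noteq> 0" and "\<bar>y - x\<bar> < \<bar>x\<bar> / 2"
  shows "y \<noteq> 0" "0 < \<bar>x\<bar> / 2" "\<bar>x\<bar> / 2 \<le> \<bar>y\<bar>"
  using assms by (auto simp: abs_if split: if_splits)

context
  fixes x \<sigma> :: real
  assumes x: "x \<noteq> 0" and \<sigma>: "0 < \<sigma>"
begin

lemma integrable_cauchy_kernel:
  "integrable lborel (\<lambda>u. cauchy_kernel (\<sigma> * u) x * half_normal u)"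
proof (rule integrable_half_normal_mult)
  show "\<bar>cauchy_kernel (\<sigma> * u) x\<bar> \<le> 1 / (pi * \<bar>x\<bar>\<^sup>2) * \<sigma> * \<bar>u\<bar> ^ 1" for u
    using cauchy_kernel_bound[OF x, of "\<bar>x\<bar>" "\<sigma> * u"] x \<sigma> by (simp add: abs_mult)
qed measurable

lemma integrable_cauchy_kernel_ds:
  "integrable lborel (\<lambda>u. u * cauchy_kernel_ds (\<sigma> * u) x * half_normal u)"
proof (rule integrable_half_normal_mult)
  show "\<bar>u * cauchy_kernel_ds (\<sigma> * u) x\<bar> \<le> 1 / (pi * x\<^sup>2) * \<bar>u\<bar> ^ 1" for u
    using mult_left_mono[OF cauchy_kernel_ds_bound[OF x, of "\<sigma> * u"], of "\<bar>u\<bar>"]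
    by (simp add: abs_mult)
qed measurable

lemma integrable_cauchy_kernel_dx:
  "integrable lborel (\<lambda>u. cauchy_kernel_dx (\<sigma> * u) x * half_normal u)"
proof (rule integrable_half_normal_mult)
  show "\<bar>cauchy_kernel_dx (\<sigma> * u) x\<bar> \<le> 1 / (pi * \<bar>x\<bar>\<^sup>2) * \<bar>u\<bar> ^ 0" for u
    using cauchy_kernel_dx_bound[OF x, of "\<bar>x\<bar>" "\<sigma> * u"] x by simp
qed measurable

lemma integrable_cauchy_kernel_dxx:
  "integrable lborel (\<lambda>u. cauchy_kernel_dxx (\<sigma> * u) x * half_normal u)"
proof (rule integrable_half_normal_mult)
  show "\<bar>cauchy_kernel_dxx (\<sigma> * u) x\<bar> \<le> 6 / (pi * \<bar>x\<bar> ^ 4) * \<sigma> * \<bar>u\<bar> ^ 1" for u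
    using cauchy_kernel_dxx_bound[OF x, of "\<bar>x\<bar>" "\<sigma> * u"] x \<sigma> by (simp add: abs_mult)
qed measurable

end

section \<open>Differentiation under the integral in position and scale\<close>

lemma integral_cauchy_kernel_has_derivative_x:
  assumes x: "x \<noteq> 0" and \<sigma>: "0 < \<sigma>"
  shows "((\<lambda>x. \<integral>u. cauchy_kernel (\<sigma> * u) x * half_normal u \<partial>lborel) has_real_derivative
      (\<integral>u. cauchy_kernel_dx (\<sigma> * u) x * half_normal u \<partial>lborel)) (at x)"
proof (rule has_real_derivative_lebesgue_integral[where d="\<bar>x\<bar> / 2" and
        h="\<lambda>u. 1 / (pi * (\<bar>x\<bar> / 2)\<^sup>2) * half_normal u"])
  fix y u assume "\<bar>y - x\<bar> < \<bar>x\<bar> / 2"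
  note y = half_abs_neighbourhood[OF x this]
  show "integrable lborel (\<lambda>u. cauchy_kernel (\<sigma> * u) y * half_normal u)"
    by (rule integrable_cauchy_kernel[OF y(1) \<sigma>])
  show "((\<lambda>y. cauchy_kernel (\<sigma> * u) y * half_normal u) has_real_derivative
      cauchy_kernel_dx (\<sigma> * u) y * half_normal u) (at y)"
    by (rule DERIV_cmult_right[OF DERIV_cauchy_kernel_x[OF y(1)]])
  show "\<bar>cauchy_kernel_dx (\<sigma> * u) y * half_normal u\<bar> \<le> 1 / (pi * (\<bar>x\<bar> / 2)\<^sup>2) * half_normal u"
    unfolding abs_mult abs_of_nonneg[OF half_normal_nonneg]
    by (intro mult_right_mono cauchy_kernel_dx_bound y half_normal_nonneg)
next
  show "integrable lborel (\<lambda>u. 1 / (pi * (\<bar>x\<bar> / 2)\<^sup>2) * half_normal u)"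
    using integrable_half_normal_moment[of 0] by simp
qed (use x in auto)

lemma integral_cauchy_kernel_has_derivative_xx:
  assumes x: "x \<noteq> 0" and \<sigma>: "0 < \<sigma>"
  shows "((\<lambda>x. \<integral>u. cauchy_kernel_dx (\<sigma> * u) x * half_normal u \<partial>lborel) has_real_derivative
      (\<integral>u. cauchy_kernel_dxx (\<sigma> * u) x * half_normal u \<partial>lborel)) (at x)"
proof (rule has_real_derivative_lebesgue_integral[where d="\<bar>x\<bar> / 2" and
        h="\<lambda>u. 6 / (pi * (\<bar>x\<bar> / 2) ^ 4) * \<bar>\<sigma> * u\<bar> * half_normal u"])
  fix y u assume "\<bar>y - x\<bar> < \<bar>x\<bar> / 2"
  note y = half_abs_neighbourhood[OF x this]
  show "integrable lborel (\<lambda>u. cauchy_kernel_dx (\<sigma> * u) y * half_normal u)"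
    by (rule integrable_cauchy_kernel_dx[OF y(1) \<sigma>])
  show "((\<lambda>y. cauchy_kernel_dx (\<sigma> * u) y * half_normal u) has_real_derivative
      cauchy_kernel_dxx (\<sigma> * u) y * half_normal u) (at y)"
    by (rule DERIV_cmult_right[OF DERIV_cauchy_kernel_dx[OF y(1)]])
  show "\<bar>cauchy_kernel_dxx (\<sigma> * u) y * half_normal u\<bar> \<le> 6 / (pi * (\<bar>x\<bar> / 2) ^ 4) * \<bar>\<sigma> * u\<bar> * half_normal u"
    unfolding abs_mult[of _ "half_normal u"] abs_of_nonneg[OF half_normal_nonneg]
    by (intro mult_right_mono cauchy_kernel_dxx_bound y half_normal_nonneg)
next
  show "integrable lborel (\<lambda>u. 6 / (pi * (\<bar>x\<bar> / 2) ^ 4) * \<bar>\<sigma> * u\<bar> * half_normal u)"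
    by (rule integrable_half_normal_mult[where c="6 / (pi * (\<bar>x\<bar> / 2) ^ 4) * \<bar>\<sigma>\<bar>" and k=1])
      (auto simp: abs_mult)
qed (use x in auto)

text \<open>Radius \<sigma> keeps all competing scales positive. The chain rule contributes a factor
  \<open>u\<close>, the only growth left once the kernel derivative is bounded uniformly in its
  first argument.\<close>

lemma integral_cauchy_kernel_has_derivative_scale:
  assumes x: "x \<noteq> 0" and \<sigma>: "0 < \<sigma>"
  shows "((\<lambda>\<sigma>. \<integral>u. cauchy_kernel (\<sigma> * u) x * half_normal u \<partial>lborel) has_real_derivative
      (\<integral>u. u * cauchy_kernel_ds (\<sigma> * u) x * half_normal u \<partial>lborel)) (at \<sigma>)"
proof (rule has_real_derivative_lebesgue_integral[where d=\<sigma> and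
        h="\<lambda>u. \<bar>u\<bar> * (1 / (pi * x\<^sup>2)) * half_normal u"])
  fix y u assume "\<bar>y - \<sigma>\<bar> < \<sigma>"
  then have y: "0 < y" by simp
  show "integrable lborel (\<lambda>u. cauchy_kernel (y * u) x * half_normal u)"
    by (rule integrable_cauchy_kernel[OF x y])
  have "((\<lambda>y. cauchy_kernel (y * u) x) has_real_derivative cauchy_kernel_ds (y * u) x * u) (at y)"
    by (rule DERIV_chain2[OF DERIV_cauchy_kernel_s[OF x]]) (auto intro!: derivative_eq_intros)
  from DERIV_cmult_right[OF this, of "half_normal u"]
  show "((\<lambda>y. cauchy_kernel (y * u) x * half_normal u) has_real_derivative
      u * cauchy_kernel_ds (y * u) x * half_normal u) (at y)"
    by (simp add: mult_ac)
  show "\<bar>u * cauchy_kernel_ds (y * u) x * half_normal u\<bar> \<le> \<bar>u\<bar> * (1 / (pi * x\<^sup>2)) * half_normal u"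
    unfolding abs_mult abs_of_nonneg[OF half_normal_nonneg]
    by (intro mult_right_mono mult_left_mono cauchy_kernel_ds_bound x half_normal_nonneg) auto
next
  show "integrable lborel (\<lambda>u. \<bar>u\<bar> * (1 / (pi * x\<^sup>2)) * half_normal u)"
    by (rule integrable_half_normal_mult[where c="1 / (pi * x\<^sup>2)" and k=1])
      (auto simp: abs_mult)
qed (use \<sigma> in auto)

section \<open>Integration by parts against the normal density\<close>

lemma std_normal_density_has_derivative:
  "(std_normal_density has_real_derivative - u * std_normal_density u) (at u)"
proof -
  have "((\<lambda>u. exp (- u\<^sup>2 / 2)) has_real_derivative - u * exp (- u\<^sup>2 / 2)) (at u)"
    by (auto intro!: derivative_eq_intros)
  from DERIV_cmult[OF this, of "1 / sqrt (2 * pi)"] show ?thesis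
    by (simp add: std_normal_density_def[abs_def] mult_ac)
qed

lemma std_normal_density_tendsto_0: "(std_normal_density \<longlongrightarrow> 0) at_top"
proof -
  have "filterlim (\<lambda>u::real. u\<^sup>2 / 2) at_top at_top"
    by real_asymp
  then have "((\<lambda>u::real. exp (- (u\<^sup>2 / 2))) \<longlongrightarrow> 0) at_top"
    by (rule filterlim_compose[OF exp_at_bot filterlim_compose[OF filterlim_uminus_at_bot_at_top]])
  from tendsto_mult_right_zero[OF this, of "1 / sqrt (2 * pi)"] show ?thesis
    unfolding std_normal_density_def[abs_def] by simp
qed

lemma integral_cauchy_kernel_by_parts:
  assumes x: "x \<noteq> 0" and \<sigma>: "0 < \<sigma>"
  shows "(\<integral>u. u * cauchy_kernel_ds (\<sigma> * u) x * half_normal u \<partial>lborel) =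
    1 / (pi * x\<^sup>2 * sqrt (2 * pi)) - \<sigma> * (\<integral>u. cauchy_kernel_dxx (\<sigma> * u) x * half_normal u \<partial>lborel)"
proof -
  \<comment> \<open>\<open>W\<close> is the product whose derivative contains both integrands:
    \<open>- u * std_normal_density u\<close> is the derivative of the density, and the inner scale
    \<sigma> produces the factor in front of \<open>cauchy_kernel_dxx\<close>.\<close>
  define W where "W u = std_normal_density u * cauchy_kernel_ds (\<sigma> * u) x" for u
  define W' where "W' u = - u * std_normal_density u * cauchy_kernel_ds (\<sigma> * u) x
      - \<sigma> * std_normal_density u * cauchy_kernel_dxx (\<sigma> * u) x" for u
  have W: "(W has_real_derivative W' u) (at u)" for u
  proof -
    have "((\<lambda>u. cauchy_kernel_ds (\<sigma> * u) x) has_real_derivative - cauchy_kernel_dxx (\<sigma> * u) x * \<sigma>) (at u)"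
      by (rule DERIV_chain2[OF DERIV_cauchy_kernel_ds[OF x]]) (auto intro!: derivative_eq_intros)
    from DERIV_mult[OF std_normal_density_has_derivative this] show ?thesis
      unfolding W_def[abs_def] W'_def by (simp add: mult_ac)
  qed
  have eq: "indicator {0<..} u * W' u = - (u * cauchy_kernel_ds (\<sigma> * u) x * half_normal u)
      - \<sigma> * (cauchy_kernel_dxx (\<sigma> * u) x * half_normal u)" for u
    by (simp add: W'_def half_normal_def algebra_simps)
  have int1: "integrable lborel (\<lambda>u. u * cauchy_kernel_ds (\<sigma> * u) x * half_normal u)"
    and int2: "integrable lborel (\<lambda>u. cauchy_kernel_dxx (\<sigma> * u) x * half_normal u)"
    using integrable_cauchy_kernel_ds integrable_cauchy_kernel_dxx x \<sigma> by auto
  \<comment> \<open>Value of \<open>W\<close> at infinity minus its value at 0. The former vanishes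
    because the kernel derivative is bounded; the latter is 1 / sqrt (2 pi) times 1 / (pi x^2), the
    kernel derivative at \<open>s\<close> = 0.\<close>
  have "(LBINT u=0..\<infinity>. W' u) = 0 - 1 / (pi * x\<^sup>2 * sqrt (2 * pi))"
  proof (rule interval_integral_FTC_integrable[where F=W])
    show "(W has_vector_derivative W' u) (at u)" for u
      using W by (simp add: has_real_derivative_iff_has_vector_derivative)
    have "s\<^sup>2 + x\<^sup>2 \<noteq> 0" for s :: real using x by simp
    then show "isCont W' u" for u
      unfolding W'_def cauchy_kernel_ds_def cauchy_kernel_dxx_def std_normal_density_def
      by (intro continuous_intros) auto
    show "set_integrable lborel (einterval 0 \<infinity>) W'"
      using int1 int2 by (simp add: set_integrable_def einterval_eq eq zero_ereal_def)
    have "W 0 = 1 / (pi * x\<^sup>2 * sqrt (2 * pi))"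
      using x by (simp add: W_def cauchy_kernel_ds_def std_normal_density_def power2_eq_square)
    moreover have "(W \<longlongrightarrow> W 0) (at_right 0)"
      using DERIV_isCont[OF W, of 0] by (simp add: isCont_def filterlim_at_split)
    ultimately show "((W \<circ> real_of_ereal) \<longlongrightarrow> 1 / (pi * x\<^sup>2 * sqrt (2 * pi))) (at_right 0)"
      by (simp add: zero_ereal_def ereal_tendsto_simps)
    have "(W \<longlongrightarrow> 0) at_top"
    proof (rule Lim_null_comparison)
      show "\<forall>\<^sub>F u in at_top. norm (W u) \<le> std_normal_density u * (1 / (pi * x\<^sup>2))"
        unfolding W_def norm_mult
        using cauchy_kernel_ds_bound[OF x] by (intro always_eventually allI mult_mono) auto
      show "((\<lambda>u. std_normal_density u * (1 / (pi * x\<^sup>2))) \<longlongrightarrow> 0) at_top"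
        by (rule tendsto_mult_left_zero[OF std_normal_density_tendsto_0])
    qed
    then show "((W \<circ> real_of_ereal) \<longlongrightarrow> 0) (at_left \<infinity>)"
      by (simp add: ereal_tendsto_simps)
  qed simp
  moreover have "(LBINT u=0..\<infinity>. W' u) = (\<integral>u. - (u * cauchy_kernel_ds (\<sigma> * u) x * half_normal u)
      - \<sigma> * (cauchy_kernel_dxx (\<sigma> * u) x * half_normal u) \<partial>lborel)"
    by (simp add: zero_ereal_def interval_integral_to_infinity_eq set_lebesgue_integral_def eq)
  ultimately show ?thesis
    using int1 int2 by simp
qed

section \<open>Derivatives of q and the heat equation\<close>

context
  fixes H t x :: real
  assumes t: "0 < t" and x: "x \<noteq> 0"
begin

lemma q_density_has_derivative_x:
  "((\<lambda>\<xi>. q_density H \<xi> t) has_real_derivative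
    2 * (\<integral>u. cauchy_kernel_dx (t powr H * u) x * half_normal u \<partial>lborel)) (at x)"
  unfolding q_density_scale[OF t]
  using t x by (intro DERIV_cmult integral_cauchy_kernel_has_derivative_x) auto

lemma q_density_has_derivative_t:
  "(q_density H x has_real_derivative
    2 * (\<integral>u. u * cauchy_kernel_ds (t powr H * u) x * half_normal u \<partial>lborel) * (H * t powr (H - 1))) (at t)"
proof -
  have p: "((\<lambda>\<tau>. \<tau> powr H) has_real_derivative H * t powr (H - 1)) (at t)"
    using has_real_derivative_powr[OF t] by simp
  have "((\<lambda>\<tau>. 2 * (\<integral>u. cauchy_kernel (\<tau> powr H * u) x * half_normal u \<partial>lborel)) has_real_derivative
      2 * ((\<integral>u. u * cauchy_kernel_ds (t powr H * u) x * half_normal u \<partial>lborel) * (H * t powr (H - 1)))) (at t)"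
    using t by (intro DERIV_cmult DERIV_chain2[OF integral_cauchy_kernel_has_derivative_scale[OF x] p]) auto
  then have "((\<lambda>\<tau>. 2 * (\<integral>u. cauchy_kernel (\<tau> powr H * u) x * half_normal u \<partial>lborel)) has_real_derivative
      2 * (\<integral>u. u * cauchy_kernel_ds (t powr H * u) x * half_normal u \<partial>lborel) * (H * t powr (H - 1))) (at t)"
    by (simp add: mult.assoc)
  then show ?thesis
    \<comment> \<open>The scaled formula for q is available at positive times only, so it is
      exchanged for q on an open set of such times.\<close>
    by (rule has_field_derivative_transform_within_open[where S="{0<..}"])
      (use t in \<open>auto simp: q_density_scale\<close>)
qed

end

lemma q_density_has_derivative_xx:
  assumes t: "0 < t" and x: "x \<noteq> 0"
  shows "(deriv (\<lambda>\<xi>. q_density H \<xi> t) has_real_derivative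
    2 * (\<integral>u. cauchy_kernel_dxx (t powr H * u) x * half_normal u \<partial>lborel)) (at x)"
proof -
  have "((\<lambda>x. 2 * (\<integral>u. cauchy_kernel_dx (t powr H * u) x * half_normal u \<partial>lborel)) has_real_derivative
    2 * (\<integral>u. cauchy_kernel_dxx (t powr H * u) x * half_normal u \<partial>lborel)) (at x)"
    using t x by (intro DERIV_cmult integral_cauchy_kernel_has_derivative_xx) auto
  \<comment> \<open>The first derivative has been identified at every nonzero position, hence on an
    open set around \<open>x\<close>; this permits differentiating \<open>deriv\<close>
    itself.\<close>
  then show ?thesis
    by (rule has_field_derivative_transform_within_open[where S="- {0}"])
      (use x in \<open>auto simp: DERIV_imp_deriv[OF q_density_has_derivative_x[OF t]]\<close>)
qed

lemma q_density_heat_equation: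
  assumes t: "0 < t" and x: "x \<noteq> 0"
  shows "deriv (\<lambda>\<tau>. q_density H x \<tau>) t =
         2 * H * t powr (H - 1) / (pi * x\<^sup>2 * sqrt (2 * pi))
         - H * t powr (2 * H - 1) * deriv (deriv (\<lambda>\<xi>. q_density H \<xi> t)) x"
proof -
  \<comment> \<open>One factor is the chain rule derivative of sigma up to \<open>H\<close>, the
    other is the sigma left by the integration by parts.\<close>
  have p: "t powr (2 * H - 1) = t powr (H - 1) * t powr H"
    by (simp add: powr_add[symmetric])
  show ?thesis
    unfolding DERIV_imp_deriv[OF q_density_has_derivative_t[OF t x]]
      DERIV_imp_deriv[OF q_density_has_derivative_xx[OF t x]] p
    by (subst integral_cauchy_kernel_by_parts) (use t x in \<open>simp_all add: algebra_simps\<close>)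
qed

section \<open>Time change by an independent random time\<close>

text \<open>Continuous ramps increase to the indicator of an open half-line, and such half-lines
  determine a finite measure on the line.\<close>

lemma measure_eqI_nn_integral_continuous:
  fixes M N :: "real measure"
  assumes sets: "sets M = sets borel" "sets N = sets borel"
    and fin: "finite_measure M"
    and eq: "\<And>f :: real \<Rightarrow> real. continuous_on UNIV f \<Longrightarrow> (\<And>x. 0 \<le> f x) \<Longrightarrow> (\<And>x. f x \<le> 1) \<Longrightarrow>
      (\<integral>\<^sup>+x. ennreal (f x) \<partial>M) = (\<integral>\<^sup>+x. ennreal (f x) \<partial>N)"
  shows "M = N"
proof (rule measure_eqI_lessThan[OF sets])
  fix a :: real
  show "emeasure M {a<..} < \<infinity>"
    using finite_measure.emeasure_finite[OF fin] by (simp add: top.not_eq_extremum)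
  \<comment> \<open>For positive \<open>n\<close> the ramp rises from 0 at \<open>a\<close> to 1 at
    a + 1/n. It is 0 at \<open>a\<close> for every \<open>n\<close>, so its limit is the indicator
    of the open half-line.\<close>
  define f where "f n y = max 0 (min 1 (real n * (y - a)))" for n y
  have cont: "continuous_on UNIV (f n)" for n
    unfolding f_def by (intro continuous_intros)
  have lim: "(\<lambda>n. \<integral>\<^sup>+y. ennreal (f n y) \<partial>K) \<longlonglongrightarrow> emeasure K {a<..}" if K: "sets K = sets borel" for K
  proof -
    have "(\<lambda>n. \<integral>\<^sup>+y. ennreal (f n y) \<partial>K) \<longlonglongrightarrow> (\<integral>\<^sup>+y. indicator {a<..} y \<partial>K)"
    proof (rule nn_integral_LIMSEQ)
      show "incseq (\<lambda>n y. ennreal (f n y))"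
      proof (intro incseq_SucI le_funI ennreal_leI)
        fix n y
        show "f n y \<le> f (Suc n) y"
        proof (cases "a \<le> y")
          case True
          then show ?thesis
            unfolding f_def by (intro max.mono min.mono mult_right_mono order_refl) auto
        next
          case False
          then have "real n * (y - a) \<le> 0" by (simp add: mult_nonneg_nonpos)
          then show ?thesis unfolding f_def by auto
        qed
      qed
      show "(\<lambda>y. ennreal (f n y)) \<in> borel_measurable K" for n
        using borel_measurable_continuous_onI[OF cont[of n]]
        by (simp add: measurable_cong_sets[OF K refl])
      fix y
      show "(\<lambda>n. ennreal (f n y)) \<longlonglongrightarrow> indicator {a<..} y"
      proof (cases "a < y")
        case True
        obtain m where m: "1 / (y - a) < real m" using reals_Archimedean2 by blast
        have "f n y = 1" if "m \<le> n" for n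
        proof -
          have "1 / (y - a) \<le> real n" using m that by linarith
          then have "1 \<le> real n * (y - a)" using True by (simp add: field_simps)
          then show ?thesis by (simp add: f_def)
        qed
        then have "\<forall>\<^sub>F n in sequentially. ennreal (f n y) = indicator {a<..} y"
          using True by (auto simp: eventually_sequentially)
        then show ?thesis by (rule tendsto_eventually)
      next
        case False
        then have "real n * (y - a) \<le> 0" for n by (simp add: mult_nonneg_nonpos)
        then have "f n y = 0" for n
          unfolding f_def by (intro max_absorb1 min.coboundedI2)
        then show ?thesis using False by simp
      qed
    qed
    then show ?thesis using K by simp
  qed
  have "(\<integral>\<^sup>+y. ennreal (f n y) \<partial>M) = (\<integral>\<^sup>+y. ennreal (f n y) \<partial>N)" for n
    by (rule eq[OF cont]) (auto simp: f_def)
  then show "emeasure M {a<..} = emeasure N {a<..}"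
    using LIMSEQ_unique[OF lim[OF sets(1)]] lim[OF sets(2)] by simp
qed

text \<open>For \<open>s\<close> \<ge> 0 this is the least multiple of 1/(n+1) strictly above
  \<open>s\<close>. Floor plus one is taken instead of the ceiling because a right limit excludes
  the point itself. Truncation by \<open>nat\<close> makes every grid time positive, even for
  negative \<open>s\<close>.\<close>

definition grid_above :: "nat \<Rightarrow> real \<Rightarrow> real" where
  "grid_above n s = real (Suc (nat \<lfloor>real (Suc n) * s\<rfloor>)) / real (Suc n)"

lemma grid_above_bounds:
  fixes s :: real
  assumes "0 \<le> s"
  shows "s < grid_above n s" "grid_above n s \<le> s + inverse (real (Suc n))"
proof -
  have k: "real (nat \<lfloor>real (Suc n) * s\<rfloor>) = of_int \<lfloor>real (Suc n) * s\<rfloor>"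
    using assms by (simp add: of_nat_nat)
  have "real (Suc n) * s < real (Suc (nat \<lfloor>real (Suc n) * s\<rfloor>))"
    unfolding of_nat_Suc[of "nat _"] k by linarith
  then show "s < grid_above n s"
    unfolding grid_above_def by (simp add: field_simps)
  have "real (Suc (nat \<lfloor>real (Suc n) * s\<rfloor>)) \<le> real (Suc n) * s + 1"
    unfolding of_nat_Suc[of "nat _"] k by linarith
  then have "grid_above n s \<le> (real (Suc n) * s + 1) / real (Suc n)"
    unfolding grid_above_def by (rule divide_right_mono) simp
  also have "\<dots> = s + inverse (real (Suc n))"
    by (simp add: add_divide_distrib inverse_eq_divide)
  finally show "grid_above n s \<le> s + inverse (real (Suc n))" .
qed

lemma grid_above_tendsto:
  assumes "0 \<le> s"
  shows "filterlim (\<lambda>n. grid_above n s) (at_right s) sequentially"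
  unfolding filterlim_at
proof (intro conjI)
  have "(\<lambda>n. s + inverse (real (Suc n))) \<longlonglongrightarrow> s + 0"
    by (intro tendsto_intros LIMSEQ_inverse_real_of_nat)
  then have up: "(\<lambda>n. s + inverse (real (Suc n))) \<longlonglongrightarrow> s" by simp
  have lo: "(\<lambda>n. s) \<longlonglongrightarrow> s" by simp
  show "(\<lambda>n. grid_above n s) \<longlonglongrightarrow> s"
    by (rule tendsto_sandwich[OF _ _ lo up])
      (use grid_above_bounds[OF assms] in \<open>auto intro!: always_eventually less_imp_le\<close>)
  show "\<forall>\<^sub>F n in sequentially. grid_above n s \<in> {s<..} \<and> grid_above n s \<noteq> s"
    using grid_above_bounds(1)[OF assms] by (intro always_eventually) (auto simp: less_imp_neq[THEN not_sym])
qed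

text \<open>The rounded time takes countably many values, so the sample space splits into countably
  many measurable pieces on which the time is constant. Measurability of \<open>X\<close> at each
  fixed nonnegative time then suffices.\<close>

lemma measurable_compose_grid_above:
  assumes X: "\<And>s. 0 \<le> s \<Longrightarrow> (\<lambda>\<omega>. X s \<omega>) \<in> measurable M N"
    and [measurable]: "R \<in> borel_measurable M"
  shows "(\<lambda>\<omega>. X (grid_above n (R \<omega>)) \<omega>) \<in> measurable M N"
  unfolding grid_above_def
  by (rule measurable_compose_countable[where f="\<lambda>k. X (real (Suc k) / real (Suc n))"])
    (auto intro!: X)

text \<open>The random time is presented as a functional of \<open>D\<close> because \<^const>\<open>prob_space.indep_var\<close>
  requires both variables to have the same type.\<close>

lemma (in prob_space) time_change_nn_integral:
  fixes C :: "real \<Rightarrow> 'a \<Rightarrow> real" and D :: "'a \<Rightarrow> real \<Rightarrow> real" and f :: "real \<Rightarrow> real"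
    and \<rho> :: "(real \<Rightarrow> real) \<Rightarrow> real"
  defines "R \<equiv> \<lambda>\<omega>. \<rho> (D \<omega>)"
  assumes indep: "indep_var (PiM {0..} (\<lambda>_. borel)) (\<lambda>\<omega>. \<lambda>t\<in>{0..}. C t \<omega>) N D"
    and \<rho>: "\<rho> \<in> borel_measurable N" "\<And>d. 0 \<le> \<rho> d"
    and right_cont: "\<And>\<omega> s. \<omega> \<in> space M \<Longrightarrow> 0 \<le> s \<Longrightarrow> continuous (at_right s) (\<lambda>t. C t \<omega>)"
  shows "(\<lambda>\<omega>. C (R \<omega>) \<omega>) \<in> borel_measurable M"
    and "\<lbrakk>continuous_on UNIV f; \<And>x. 0 \<le> f x; \<And>x. f x \<le> 1\<rbrakk> \<Longrightarrow>
      (\<integral>\<^sup>+\<omega>. ennreal (f (C (R \<omega>) \<omega>)) \<partial>M) = (\<integral>\<^sup>+\<omega>. (\<integral>\<^sup>+\<omega>'. ennreal (f (C (R \<omega>) \<omega>')) \<partial>M) \<partial>M)"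
proof -
  let ?P = "PiM {0..} (\<lambda>_. borel) :: (real \<Rightarrow> real) measure"
  let ?C = "\<lambda>\<omega>. \<lambda>t\<in>{0..}. C t \<omega>"
  have Cm: "?C \<in> measurable M ?P" and Dm: "D \<in> measurable M N"
    using indep_var_rv1[OF indep] indep_var_rv2[OF indep] by auto
  have Rm [measurable]: "R \<in> borel_measurable M"
    unfolding R_def by (rule measurable_compose[OF Dm \<rho>(1)])
  have R: "0 \<le> R \<omega>" for \<omega>
    unfolding R_def by (rule \<rho>(2))
  have C_meas: "C s \<in> borel_measurable M" if "0 \<le> s" for s
    using measurable_compose[OF Cm measurable_component_singleton[of s "{0..}"]] that by simp
  have pos: "0 \<le> grid_above n s" if "0 \<le> s" for n s
    using grid_above_bounds(1)[OF that, of n] that by linarith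
  have lim_path: "(\<lambda>n. C (grid_above n s) \<omega>) \<longlonglongrightarrow> C s \<omega>" if "\<omega> \<in> space M" "0 \<le> s" for \<omega> s
    using filterlim_compose[OF right_cont[OF that, unfolded continuous_within] grid_above_tendsto[OF that(2)]] .
  have meas_n: "(\<lambda>\<omega>. C (grid_above n (R \<omega>)) \<omega>) \<in> borel_measurable M" for n
    by (rule measurable_compose_grid_above[OF C_meas Rm])
  show lim_meas: "(\<lambda>\<omega>. C (R \<omega>) \<omega>) \<in> borel_measurable M"
    by (rule borel_measurable_LIMSEQ_real[OF lim_path[OF _ R] meas_n])

  assume cont: "continuous_on UNIV f" and f0: "\<And>x. 0 \<le> f x" and f1: "\<And>x. f x \<le> 1"
  have fm [measurable]: "f \<in> borel_measurable borel"
    by (rule borel_measurable_continuous_onI[OF cont])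
  have lim_f: "(\<lambda>n. ennreal (f (C (grid_above n s) \<omega>))) \<longlonglongrightarrow> ennreal (f (C s \<omega>))"
    if "\<omega> \<in> space M" "0 \<le> s" for \<omega> s
    using cont lim_path[OF that] by (intro tendsto_ennrealI) (auto simp: continuous_on_eq_continuous_at intro: isCont_tendsto_compose)
  \<comment> \<open>\<open>F s\<close> is the mean of \<open>f\<close> under the law of
    \<open>C\<close> at the fixed time \<open>s\<close>; the goal is that the mean of
    \<open>f\<close> along the random time equals the mean of \<open>F\<close> at that time.\<close>
  define F where "F s = (\<integral>\<^sup>+\<omega>. ennreal (f (C s \<omega>)) \<partial>M)" for s
  have F1: "F s \<le> 1" for s
  proof -
    have "F s \<le> (\<integral>\<^sup>+\<omega>. 1 \<partial>M)"
      unfolding F_def using f1 by (intro nn_integral_mono) (auto simp: ennreal_le_1)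
    then show ?thesis by (simp add: emeasure_space_1)
  qed
  have lim_F: "(\<lambda>n. F (grid_above n s)) \<longlonglongrightarrow> F s" if s: "0 \<le> s" for s
    unfolding F_def
  proof (rule nn_integral_dominated_convergence[where w="\<lambda>_. 1"])
    show "(\<lambda>\<omega>. ennreal (f (C (grid_above n s) \<omega>))) \<in> borel_measurable M" for n
      using C_meas[OF pos[OF s, of n]] by measurable
    show "(\<lambda>\<omega>. ennreal (f (C s \<omega>))) \<in> borel_measurable M"
      using C_meas[OF s] by measurable
  qed (use f1 lim_f[OF _ s] in \<open>auto simp: emeasure_space_1 ennreal_le_1\<close>)
  \<comment> \<open>Measurability of \<open>F\<close> in \<open>s\<close> is not known beforehand.
    After rounding only countably many values of \<open>F\<close> occur, and measurability at
    \<open>R\<close> itself follows in the limit.\<close>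
  have F_meas: "(\<lambda>\<omega>. F (grid_above n (R \<omega>))) \<in> borel_measurable M" for n
    by (rule measurable_compose_grid_above[of "\<lambda>s \<omega>. F s", OF _ Rm]) simp
  have step: "(\<integral>\<^sup>+\<omega>. ennreal (f (C (grid_above n (R \<omega>)) \<omega>)) \<partial>M) = (\<integral>\<^sup>+\<omega>. F (grid_above n (R \<omega>)) \<partial>M)" for n
  proof -
    let ?\<Phi> = "\<lambda>p :: (real \<Rightarrow> real) \<times> (real \<Rightarrow> real). ennreal (f (fst p (grid_above n (\<rho> (snd p)))))"
    have "(\<lambda>p. fst p (grid_above n (\<rho> (snd p)))) \<in> borel_measurable (?P \<Otimes>\<^sub>M N)"
      by (rule measurable_compose_grid_above[of "\<lambda>s p. fst p s"])
        (auto intro!: measurable_compose[OF measurable_fst] measurable_compose[OF measurable_snd \<rho>(1)] measurable_component_singleton)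
    then have \<Phi>m: "?\<Phi> \<in> borel_measurable (?P \<Otimes>\<^sub>M N)"
      by measurable
    \<comment> \<open>Independence is used here: the joint law of the path of \<open>C\<close> and
      of \<open>D\<close> is a product, so \<open>D\<close> can be frozen while the path is
      integrated out.\<close>
    have prod: "distr M ?P ?C \<Otimes>\<^sub>M distr M N D = distr M (?P \<Otimes>\<^sub>M N) (\<lambda>\<omega>. (?C \<omega>, D \<omega>))"
      using indep unfolding indep_var_distribution_eq by simp
    interpret D1: prob_space "distr M ?P ?C" by (rule prob_space_distr[OF Cm])
    interpret D2: prob_space "distr M N D" by (rule prob_space_distr[OF Dm])
    interpret PP: pair_sigma_finite "distr M ?P ?C" "distr M N D" ..
    have \<Phi>m': "?\<Phi> \<in> borel_measurable (distr M ?P ?C \<Otimes>\<^sub>M distr M N D)"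
      using \<Phi>m unfolding prod by simp
    \<comment> \<open>Restricting the path to nonnegative times changes nothing, since all grid
      times are nonnegative.\<close>
    have "(\<integral>\<^sup>+\<omega>. ennreal (f (C (grid_above n (R \<omega>)) \<omega>)) \<partial>M) = (\<integral>\<^sup>+\<omega>. ?\<Phi> (?C \<omega>, D \<omega>) \<partial>M)"
      using pos[OF R] by (simp add: R_def)
    also have "\<dots> = (\<integral>\<^sup>+p. ?\<Phi> p \<partial>distr M (?P \<Otimes>\<^sub>M N) (\<lambda>\<omega>. (?C \<omega>, D \<omega>)))"
      using Cm Dm \<Phi>m by (intro nn_integral_distr[symmetric] measurable_Pair) auto
    also have "\<dots> = (\<integral>\<^sup>+d. (\<integral>\<^sup>+c. ?\<Phi> (c, d) \<partial>distr M ?P ?C) \<partial>distr M N D)"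
      unfolding prod[symmetric] by (rule PP.nn_integral_snd[OF \<Phi>m', symmetric])
    also have "\<dots> = (\<integral>\<^sup>+\<omega>. (\<integral>\<^sup>+c. ?\<Phi> (c, D \<omega>) \<partial>distr M ?P ?C) \<partial>M)"
      using D1.borel_measurable_nn_integral[of "\<lambda>d c. ?\<Phi> (c, d)" N]
        measurable_compose[OF measurable_pair_swap' \<Phi>m]
      by (intro nn_integral_distr[OF Dm]) (simp add: split_beta')
    also have "\<dots> = (\<integral>\<^sup>+\<omega>. F (grid_above n (R \<omega>)) \<partial>M)"
    proof (rule nn_integral_cong)
      fix \<omega>
      have "(\<lambda>c. c (grid_above n (R \<omega>))) \<in> borel_measurable ?P"
        using pos[OF R] by (intro measurable_component_singleton) auto
      then show "(\<integral>\<^sup>+c. ?\<Phi> (c, D \<omega>) \<partial>distr M ?P ?C) = F (grid_above n (R \<omega>))"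
        using pos[OF R] unfolding F_def R_def by (subst nn_integral_distr[OF Cm]) auto
    qed
    finally show ?thesis .
  qed
  have "(\<lambda>n. \<integral>\<^sup>+\<omega>. ennreal (f (C (grid_above n (R \<omega>)) \<omega>)) \<partial>M) \<longlonglongrightarrow> (\<integral>\<^sup>+\<omega>. ennreal (f (C (R \<omega>) \<omega>)) \<partial>M)"
    by (rule nn_integral_dominated_convergence[where w="\<lambda>_. 1"])
      (use f1 lim_f[OF _ R] meas_n lim_meas in \<open>auto simp: emeasure_space_1 ennreal_le_1\<close>)
  moreover have "(\<lambda>n. \<integral>\<^sup>+\<omega>. F (grid_above n (R \<omega>)) \<partial>M) \<longlonglongrightarrow> (\<integral>\<^sup>+\<omega>. F (R \<omega>) \<partial>M)"
  proof (rule nn_integral_dominated_convergence[where w="\<lambda>_. 1"])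
    show "(\<lambda>\<omega>. F (R \<omega>)) \<in> borel_measurable M"
      by (rule borel_measurable_LIMSEQ_order[OF lim_F[OF R] F_meas])
  qed (use F1 lim_F[OF R] F_meas in \<open>auto simp: emeasure_space_1\<close>)
  ultimately show "(\<integral>\<^sup>+\<omega>. ennreal (f (C (R \<omega>) \<omega>)) \<partial>M) = (\<integral>\<^sup>+\<omega>. (\<integral>\<^sup>+\<omega>'. ennreal (f (C (R \<omega>) \<omega>')) \<partial>M) \<partial>M)"
    unfolding step F_def by (rule LIMSEQ_unique)
qed

section \<open>The Cauchy process at a fractional Brownian time\<close>

text \<open>Mean 0 and second moment t^(2H) identify the Gaussian law; positivity of this second
  moment rules out the degenerate case.\<close>

lemma (in prob_space) fractional_brownian_motion_distributed:
  assumes B: "fractional_brownian_motion M H B" and t: "0 < t"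
  shows "distributed M lborel (B t) (\<lambda>x. ennreal (normal_density 0 (t powr H) x))"
proof -
  have mean: "expectation (B t) = 0"
    using B t by (simp add: fractional_brownian_motion_def)
  have "expectation (\<lambda>\<omega>. B t \<omega> * B t \<omega>) =
      (\<bar>t\<bar> powr (2 * H) + \<bar>t\<bar> powr (2 * H) - \<bar>t - t\<bar> powr (2 * H)) / 2"
    using B less_imp_le[OF t] unfolding fractional_brownian_motion_def by blast
  then have second: "expectation (\<lambda>\<omega>. B t \<omega> * B t \<omega>) = t powr (2 * H)"
    using t by simp
  have "gaussian_process M B"
    using B by (simp add: fractional_brownian_motion_def)
  from this[unfolded gaussian_process_def, rule_format, of "{t}" "\<lambda>_. 1"]
  have "gaussian_variable M (B t)"
    using t by simp
  then have [measurable]: "B t \<in> borel_measurable M"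
    and "(\<exists>\<mu>. AE \<omega> in M. B t \<omega> = \<mu>) \<or>
      (\<exists>\<mu> \<sigma>. 0 < \<sigma> \<and> distributed M lborel (B t) (\<lambda>x. ennreal (normal_density \<mu> \<sigma> x)))"
    unfolding gaussian_variable_def by simp_all
  from this(2) show ?thesis
  proof (elim disjE exE conjE)
    fix \<mu> assume \<mu>: "AE \<omega> in M. B t \<omega> = \<mu>"
    have "expectation (B t) = expectation (\<lambda>_. \<mu>)"
      using \<mu> by (intro integral_cong_AE) auto
    then have "\<mu> = 0" using mean by (simp add: prob_space)
    moreover have "expectation (\<lambda>\<omega>. B t \<omega> * B t \<omega>) = expectation (\<lambda>_. \<mu> * \<mu>)"
      using \<mu> by (intro integral_cong_AE) auto
    ultimately show ?thesis using second t by simp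
  next
    fix \<mu> \<sigma> assume \<sigma>: "0 < \<sigma>" and D: "distributed M lborel (B t) (\<lambda>x. ennreal (normal_density \<mu> \<sigma> x))"
    have \<mu>: "\<mu> = 0"
      using normal_distributed_expectation[OF \<sigma> D] mean by simp
    have "\<sigma>\<^sup>2 = expectation (\<lambda>\<omega>. B t \<omega> * B t \<omega>)"
      using normal_distributed_variance[OF \<sigma> D] mean by (simp add: power2_eq_square)
    also have "\<dots> = (t powr H)\<^sup>2"
      unfolding second by (simp add: power2_eq_square powr_add[symmetric])
    finally have "\<sigma> = t powr H"
      using \<sigma> by simp
    with D \<mu> show ?thesis by simp
  qed
qed

text \<open>The integrand is even in \<open>y\<close>, which accounts for the half-line and the
  factor 2 in q. At \<open>x\<close> = 0 the left side is infinite while \<open>q_density\<close> is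
  0 by convention, so that point is excluded.\<close>

lemma nn_integral_normal_cauchy_kernel:
  assumes t: "0 < t" and x: "x \<noteq> 0"
  shows "(\<integral>\<^sup>+y. ennreal (normal_density 0 (t powr H) y) * ennreal (cauchy_kernel \<bar>y\<bar> x) \<partial>lborel) =
    ennreal (q_density H x t)"
proof -
  define \<sigma> where "\<sigma> = t powr H"
  have \<sigma>: "0 < \<sigma>" using t by (simp add: \<sigma>_def)
  define f where "f u = std_normal_density u * cauchy_kernel \<bar>\<sigma> * u\<bar> x" for u
  have f0: "0 \<le> f u" for u
    by (simp add: f_def cauchy_kernel_def)
  have scale: "ennreal \<bar>\<sigma>\<bar> * (ennreal (normal_density 0 \<sigma> (0 + \<sigma> * u)) * ennreal (cauchy_kernel \<bar>0 + \<sigma> * u\<bar> x)) = ennreal (f u)" for u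
  proof -
    have "\<sigma> * normal_density 0 \<sigma> (\<sigma> * u) = std_normal_density u"
      using \<sigma> by (simp add: normal_density_def power_mult_distrib real_sqrt_mult)
    then have "f u = \<bar>\<sigma>\<bar> * (normal_density 0 \<sigma> (0 + \<sigma> * u) * cauchy_kernel \<bar>0 + \<sigma> * u\<bar> x)"
      using \<sigma> by (simp add: f_def mult.assoc[symmetric])
    moreover have "0 \<le> cauchy_kernel \<bar>0 + \<sigma> * u\<bar> x"
      by (simp add: cauchy_kernel_def)
    ultimately show ?thesis
      by (simp add: ennreal_mult)
  qed
  have "(\<integral>\<^sup>+y. ennreal (normal_density 0 \<sigma> y) * ennreal (cauchy_kernel \<bar>y\<bar> x) \<partial>lborel) =
      ennreal \<bar>\<sigma>\<bar> * (\<integral>\<^sup>+u. ennreal (normal_density 0 \<sigma> (0 + \<sigma> * u)) * ennreal (cauchy_kernel \<bar>0 + \<sigma> * u\<bar> x) \<partial>lborel)"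
    using \<sigma> by (intro nn_integral_real_affine) auto
  also have "\<dots> = (\<integral>\<^sup>+u. ennreal (f u) \<partial>lborel)"
    unfolding scale[symmetric] by (rule nn_integral_cmult[symmetric]) measurable
  also have "\<dots> = ennreal (q_density H x t)"
  proof -
    have half: "indicator {0..} u *\<^sub>R f u = cauchy_kernel (\<sigma> * u) x * half_normal u" for u
      using \<sigma> by (cases u "0 :: real" rule: linorder_cases)
        (auto simp: f_def half_normal_def cauchy_kernel_def abs_mult)
    have "has_bochner_integral lborel (\<lambda>u. indicator {0..} u *\<^sub>R f u)
        (\<integral>u. cauchy_kernel (\<sigma> * u) x * half_normal u \<partial>lborel)"
      unfolding half by (rule has_bochner_integral_integrable[OF integrable_cauchy_kernel[OF x \<sigma>]])
    then have "has_bochner_integral lborel f (2 *\<^sub>R (\<integral>u. cauchy_kernel (\<sigma> * u) x * half_normal u \<partial>lborel))"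
      by (rule has_bochner_integral_even_function) (simp add: f_def std_normal_density_def)
    then have "has_bochner_integral lborel f (q_density H x t)"
      by (simp add: q_density_scale[OF t] \<sigma>_def)
    then show ?thesis
      using f0 by (simp add: has_bochner_integral_iff nn_integral_eq_integral)
  qed
  finally show ?thesis unfolding \<sigma>_def .
qed

lemma q_density_measurable:
  assumes "0 < t"
  shows "(\<lambda>x. q_density H x t) \<in> borel_measurable borel"
  unfolding q_density_scale[OF assms] by measurable

text \<open>Given B(t) = y, the value has the Cauchy density of time |y|. Mixing over the Gaussian
  law of B(t) and exchanging the integrals by Tonelli leaves q as density.\<close>

lemma (in prob_space) cauchy_process_time_change_distributed:
  assumes C: "cauchy_process M C" and B: "fractional_brownian_motion M H B"
    and indep: "independent_processes M C B" and t: "0 < t"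
  shows "distributed M lborel (\<lambda>\<omega>. C \<bar>B t \<omega>\<bar> \<omega>) (\<lambda>x. ennreal (q_density H x t))"
proof -
  have Bt: "distributed M lborel (B t) (\<lambda>x. ennreal (normal_density 0 (t powr H) x))"
    by (rule fractional_brownian_motion_distributed[OF B t])
  have Cs: "distributed M lborel (C s) (\<lambda>x. ennreal (cauchy_kernel s x))" if "0 < s" for s
    using C that by (simp add: cauchy_process_def cauchy_kernel_def)
  have right_cont: "continuous (at_right s) (\<lambda>t. C t \<omega>)" if "\<omega> \<in> space M" "0 \<le> s" for \<omega> s
    using C that by (auto simp: cauchy_process_def levy_process_def cadlag_on_nonneg_def)
  have \<rho>: "(\<lambda>d. \<bar>d t\<bar>) \<in> borel_measurable (PiM {0..} (\<lambda>_. borel :: real measure))"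
    using measurable_component_singleton[of t "{0..}" "\<lambda>_. borel :: real measure"] t by simp
  have Bt_eq: "(\<lambda>t\<in>{0..}. B t \<omega>) t = B t \<omega>" for \<omega>
    using t by simp
  note time_change = time_change_nn_integral[OF indep[unfolded independent_processes_def] \<rho> abs_ge_zero right_cont,
      unfolded Bt_eq]
  have Xm: "(\<lambda>\<omega>. C \<bar>B t \<omega>\<bar> \<omega>) \<in> borel_measurable M"
    by (rule time_change(1))
  have qm [measurable]: "(\<lambda>x. ennreal (q_density H x t)) \<in> borel_measurable lborel"
    using q_density_measurable[OF t] by simp
  have "distr M lborel (\<lambda>\<omega>. C \<bar>B t \<omega>\<bar> \<omega>) = density lborel (\<lambda>x. ennreal (q_density H x t))"
  proof (rule measure_eqI_nn_integral_continuous)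
    show "finite_measure (distr M lborel (\<lambda>\<omega>. C \<bar>B t \<omega>\<bar> \<omega>))"
      using Xm by (intro finite_measure_distr) simp
    fix f :: "real \<Rightarrow> real"
    assume cont: "continuous_on UNIV f" and f0: "\<And>x. 0 \<le> f x" and f1: "\<And>x. f x \<le> 1"
    have [measurable]: "f \<in> borel_measurable borel"
      by (rule borel_measurable_continuous_onI[OF cont])
    let ?G = "\<lambda>s. \<integral>\<^sup>+x. ennreal (cauchy_kernel s x) * ennreal (f x) \<partial>lborel"
    let ?n = "\<lambda>y. ennreal (normal_density 0 (t powr H) y)"
    have "(\<integral>\<^sup>+x. ennreal (f x) \<partial>distr M lborel (\<lambda>\<omega>. C \<bar>B t \<omega>\<bar> \<omega>)) =
        (\<integral>\<^sup>+\<omega>. ennreal (f (C \<bar>B t \<omega>\<bar> \<omega>)) \<partial>M)"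
      using Xm by (intro nn_integral_distr) auto
    also have "\<dots> = (\<integral>\<^sup>+\<omega>. (\<integral>\<^sup>+\<omega>'. ennreal (f (C \<bar>B t \<omega>\<bar> \<omega>')) \<partial>M) \<partial>M)"
      by (rule time_change(2)[OF _ _ cont f0 f1])
    also have "\<dots> = (\<integral>\<^sup>+\<omega>. ?G \<bar>B t \<omega>\<bar> \<partial>M)"
    proof (rule nn_integral_cong_AE)
      \<comment> \<open>At time 0 the Cauchy process has no density; B(t) = 0 is a null event
        because B(t) has a density.\<close>
      have "AE \<omega> in M. B t \<omega> \<noteq> 0"
        by (subst distributed_AE2[OF Bt]) (auto intro: AE_mp[OF AE_lborel_singleton[of 0]])
      then show "AE \<omega> in M. (\<integral>\<^sup>+\<omega>'. ennreal (f (C \<bar>B t \<omega>\<bar> \<omega>')) \<partial>M) = ?G \<bar>B t \<omega>\<bar>"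
      proof eventually_elim
        case (elim \<omega>)
        then show ?case
          by (intro distributed_nn_integral[OF Cs, symmetric]) auto
      qed
    qed
    also have "\<dots> = (\<integral>\<^sup>+y. ?n y * ?G \<bar>y\<bar> \<partial>lborel)"
      by (rule distributed_nn_integral[OF Bt, symmetric]) measurable
    also have "\<dots> = (\<integral>\<^sup>+y. (\<integral>\<^sup>+x. ?n y * (ennreal (cauchy_kernel \<bar>y\<bar> x) * ennreal (f x)) \<partial>lborel) \<partial>lborel)"
      by (subst nn_integral_cmult) auto
    also have "\<dots> = (\<integral>\<^sup>+x. (\<integral>\<^sup>+y. ?n y * (ennreal (cauchy_kernel \<bar>y\<bar> x) * ennreal (f x)) \<partial>lborel) \<partial>lborel)"
      by (rule lborel_pair.Fubini') measurable
    also have "\<dots> = (\<integral>\<^sup>+x. ennreal (q_density H x t) * ennreal (f x) \<partial>lborel)"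
    proof (rule nn_integral_cong_AE, rule AE_mp[OF AE_lborel_singleton[of 0]], rule AE_I2, rule impI)
      fix x :: real assume x: "x \<noteq> 0"
      have "(\<integral>\<^sup>+y. ?n y * (ennreal (cauchy_kernel \<bar>y\<bar> x) * ennreal (f x)) \<partial>lborel) =
          (\<integral>\<^sup>+y. ?n y * ennreal (cauchy_kernel \<bar>y\<bar> x) \<partial>lborel) * ennreal (f x)"
        unfolding mult.assoc[symmetric] by (rule nn_integral_multc) measurable
      then show "(\<integral>\<^sup>+y. ?n y * (ennreal (cauchy_kernel \<bar>y\<bar> x) * ennreal (f x)) \<partial>lborel) =
          ennreal (q_density H x t) * ennreal (f x)"
        by (simp only: nn_integral_normal_cauchy_kernel[OF t x])
    qed
    also have "\<dots> = (\<integral>\<^sup>+x. ennreal (f x) \<partial>density lborel (\<lambda>x. ennreal (q_density H x t)))"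
      by (rule nn_integral_density[symmetric]) auto
    finally show "(\<integral>\<^sup>+x. ennreal (f x) \<partial>distr M lborel (\<lambda>\<omega>. C \<bar>B t \<omega>\<bar> \<omega>)) =
      (\<integral>\<^sup>+x. ennreal (f x) \<partial>density lborel (\<lambda>x. ennreal (q_density H x t)))" .
  qed auto
  then show ?thesis
    using Xm qm by (simp add: distributed_def)
qed

text \<open>Since \<open>deriv\<close> is a choice operator, the equation says something about
  derivatives only together with the differentiability conjuncts.\<close>

theorem mainTheorem14:
  fixes M :: "'a measure" and C B :: "real \<Rightarrow> 'a \<Rightarrow> real" and H :: real
  assumes "prob_space M"
    and "0 < H" and "H < 1"
    and "cauchy_process M C"
    and "fractional_brownian_motion M H B"
    and "independent_processes M C B"
  shows "(\<forall>t>0. distributed M lborel (\<lambda>\<omega>. C \<bar>B t \<omega>\<bar> \<omega>) (\<lambda>x. ennreal (q_density H x t))) \<and>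
    (\<forall>t>0. \<forall>x. x \<noteq> 0 \<longrightarrow>
       (\<lambda>\<tau>. q_density H x \<tau>) field_differentiable (at t) \<and>
       (\<lambda>\<xi>. q_density H \<xi> t) field_differentiable (at x) \<and>
       deriv (\<lambda>\<xi>. q_density H \<xi> t) field_differentiable (at x) \<and>
       deriv (\<lambda>\<tau>. q_density H x \<tau>) t =
         2 * H * t powr (H - 1) / (pi * x\<^sup>2 * sqrt (2 * pi))
         - H * t powr (2 * H - 1) * deriv (deriv (\<lambda>\<xi>. q_density H \<xi> t)) x)"
proof (intro conjI allI impI)
  fix t x :: real
  assume t: "0 < t"
  show "distributed M lborel (\<lambda>\<omega>. C \<bar>B t \<omega>\<bar> \<omega>) (\<lambda>x. ennreal (q_density H x t))"
    by (rule prob_space.cauchy_process_time_change_distributed[OF assms(1,4-6) t])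
  assume x: "x \<noteq> 0"
  show "(\<lambda>\<tau>. q_density H x \<tau>) field_differentiable (at t)"
    using q_density_has_derivative_t[OF t x] by (auto simp: field_differentiable_def)
  show "(\<lambda>\<xi>. q_density H \<xi> t) field_differentiable (at x)"
    using q_density_has_derivative_x[OF t x] by (auto simp: field_differentiable_def)
  show "deriv (\<lambda>\<xi>. q_density H \<xi> t) field_differentiable (at x)"
    using q_density_has_derivative_xx[OF t x] by (auto simp: field_differentiable_def)
  show "deriv (\<lambda>\<tau>. q_density H x \<tau>) t =
         2 * H * t powr (H - 1) / (pi * x\<^sup>2 * sqrt (2 * pi))
         - H * t powr (2 * H - 1) * deriv (deriv (\<lambda>\<xi>. q_density H \<xi> t)) x"
    by (rule q_density_heat_equation[OF t x])
qed

end
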